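(* Let $(V,E,\mathbf 1_r)$ be a root-reward tree. For every $v\in O$, the function $\lambda\mapsto h(\lambda,v)$ is differentiable on $(0,\infty)$.
   Context: A root-reward tree $(V,E,\mathbf 1_r)$ consists of a finite rooted tree $(V,E)$ whose root $r$ is a leaf; $B$ is the set of all leaves (including $r$), $O=V\setminus B$ is non-empty, and $p=\mathbf 1_r:B\to\{0,1\}$. Write $u\sim v$ for adjacency. For $\lambda\in[0,\infty)$, $h(\lambda,\cdot):V\to[0,\infty)$ is the unique solution of: $h(\lambda,v)=p(v)$ for $v\in B$, and $h(\lambda,v)=\frac{\lambda}{\lambda+1}\max_{u\sim v}h(\lambda,u)+\frac1{\lambda+1}\min_{u\sim v}h(\lambda,u)$ for $v\in O$. *)

theory Defs
  imports Complex_Main "HOL-Library.FuncSet" "HOL-Library.Indicator_Function"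
    "Graph_Theory.Graph_Theory"
begin

text \<open>
  A finite simple undirected graph is a symmetric loop-free finite digraph (locale
  \<^locale>\<open>pair_graph\<close>), so each edge occurs as two opposite arcs. The library predicate
  \<^const>\<open>tree\<close> cannot be used for such graphs: it forbids every directed cycle, including
  the walk that traverses one edge back and forth. Undirected cycles are exactly the directed
  cycles of length at least 3.
\<close>

definition undirected_tree :: "'a pair_pre_digraph \<Rightarrow> bool" where
  "undirected_tree G \<longleftrightarrow>
     pair_graph G \<and> Digraph_Component.connected (with_proj G) \<and>
     (\<nexists>p. pre_digraph.cycle (with_proj G) p \<and> length p \<ge> 3)"

definition nbrs :: "'a pair_pre_digraph \<Rightarrow> 'a \<Rightarrow> 'a set" where
  "nbrs G v = {u. (v, u) \<in> parcs G}"

definition leaves :: "'a pair_pre_digraph \<Rightarrow> 'a set" where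
  "leaves G = {v \<in> pverts G. card (nbrs G v) = 1}"

definition inner_verts :: "'a pair_pre_digraph \<Rightarrow> 'a set" where
  "inner_verts G = pverts G - leaves G"

text \<open>The payoff \<open>1\<^sub>r\<close> is determined by \<open>r\<close>, so a root-reward tree is given by \<open>G\<close> and \<open>r\<close>.\<close>

definition root_reward_tree :: "'a pair_pre_digraph \<Rightarrow> 'a \<Rightarrow> bool" where
  "root_reward_tree G r \<longleftrightarrow> undirected_tree G \<and> r \<in> leaves G \<and> inner_verts G \<noteq> {}"

definition is_value ::
    "'a pair_pre_digraph \<Rightarrow> ('a \<Rightarrow> real) \<Rightarrow> real \<Rightarrow> ('a \<Rightarrow> real) \<Rightarrow> bool" where
  "is_value G p l f \<longleftrightarrow>
     f \<in> pverts G \<rightarrow>\<^sub>E {0..} \<and>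
     (\<forall>v\<in>leaves G. f v = p v) \<and>
     (\<forall>v\<in>inner_verts G.
        f v = l / (l + 1) * Max (f ` nbrs G v) + 1 / (l + 1) * Min (f ` nbrs G v))"

text \<open>
  The unique value function. Only \<open>l \<ge> 0\<close> is meaningful. Functions on the vertex set are
  extensional (\<^const>\<open>PiE\<close> above), since otherwise uniqueness would fail outside the vertex set;
  at \<open>l = 0\<close> uniqueness moreover relies on the codomain \<open>[0,\<infinity>)\<close>.
\<close>

definition value_fun :: "'a pair_pre_digraph \<Rightarrow> 'a \<Rightarrow> real \<Rightarrow> 'a \<Rightarrow> real" where
  "value_fun G r l = (THE f. is_value G (indicator {r}) l f)"

end

theory Submission
  imports Defs
begin

text \<open>
  On a root-reward tree the value has an explicit formula, rational in $\lambda$ with no pole on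
  the positive half-line.

  The only positive reward lies at the root, so the maximum over the neighbours of an inner vertex
  is attained at its parent and the minimum at one of its children. The equation at $v$ is
  homogeneous in the value at the parent. Hence, by recursion from the leaves upwards, the value at
  $v$ should be $q_v$ times the value at the parent of $v$, where $q_v$ depends only on the tree
  below $v$: it is $0$ at a leaf, and
  \[ q_v = \frac{\lambda}{\lambda + 1 - \min_c q_c} \]
  at an inner vertex, with $c$ ranging over the children of $v$. The right-hand side increases with
  $\min_c q_c$, so only the distance $k$ from $v$ to the nearest leaf below it matters, and
  \<^emph>\<open>a minimal child can be chosen independently of $\lambda$\<close>. This is what
  rules out kinks: $q_v$ is the $k$-th iterate of $t \mapsto \lambda / (\lambda + 1 - t)$ at $0$,
  which is a smooth function of $\lambda > 0$ because all iterates stay below $1$. The value at $v$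
  is the product of the $q_u$ over the path of vertices $u$ from $v$ up to, but excluding, the root.

  Three facts make this rigorous. In a connected graph without cycles of length at least $3$, every
  vertex other than the root has exactly one neighbour that is not farther from the root, its parent
  (\<open>nbr_not_deeper_unique\<close>). The product solves the defining equations
  (\<open>path_value_is_value\<close>). For $\lambda > 0$ a maximum principle shows that these equations
  have at most one solution (\<open>value_unique\<close>), so the value function is the product.
\<close>

section \<open>Parents and children in a rooted undirected tree\<close>

locale rooted_undirected_tree = pair_graph G for G :: "'a pair_pre_digraph" +
  fixes r :: 'a
  assumes connected_tree: "Digraph_Component.connected (with_proj G)"
    and no_cycle: "\<And>p. pre_digraph.cycle (with_proj G) p \<Longrightarrow> length p < 3"
    and root_vert: "r \<in> pverts G"
begin

lemma arc_swap: "(u, v) \<in> parcs G \<Longrightarrow> (v, u) \<in> parcs G"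
  using arcs_ends_symmetric[OF pair_sym_arcs] by simp

lemma nbrs_sym: "u \<in> nbrs G v \<Longrightarrow> v \<in> nbrs G u"
  by (auto simp: nbrs_def arc_swap)

lemma nbrs_subset: "nbrs G v \<subseteq> pverts G"
  by (auto simp: nbrs_def in_arcsD2)

lemma nbrs_vertD: "u \<in> nbrs G v \<Longrightarrow> v \<in> pverts G"
  by (auto simp: nbrs_def in_arcsD1)

lemma finite_nbrs: "finite (nbrs G v)"
  using nbrs_subset pair_finite_verts by (rule finite_subset)

text \<open>
  Shortcutting a walk to a path only drops arcs, so the path still avoids \<open>v\<close>.
\<close>

lemma avoiding_walk_imp_apath:
  assumes "(u, w) \<in> {(a, b) \<in> parcs G. a \<noteq> v \<and> b \<noteq> v}\<^sup>*"
    and "u \<in> pverts G" "u \<noteq> v"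
  obtains p where "apath u p w" "v \<notin> set (pawalk_verts u p)"
proof -
  have "\<exists>p. awalk u p w \<and> v \<notin> set (pawalk_verts u p)"
    using assms
  proof (induction rule: converse_rtrancl_induct)
    case base
    then show ?case by (intro exI[of _ "[]"]) (simp add: awalk_Nil_iff)
  next
    case (step y z)
    then obtain p where "awalk z p w" "v \<notin> set (pawalk_verts z p)"
      using in_arcsD2 by auto
    with step show ?case
      by (intro exI[of _ "(y, z) # p"]) (auto simp: awalk_Cons_iff)
  qed
  then obtain p where p: "awalk u p w" "v \<notin> set (pawalk_verts u p)" by blast
  let ?q = "awalk_to_apath p"
  have q: "apath u ?q w" using p(1) by (rule apath_awalk_to_apath)
  have "set ?q \<subseteq> set p" using p(1) by (rule awalk_to_apath_subset)
  then have "set (pawalk_verts u ?q) \<subseteq> set (pawalk_verts u p)"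
    using set_awalk_verts[OF p(1)] set_awalk_verts[OF awalkI_apath[OF q]] by auto
  with p q that show thesis by blast
qed

text \<open>
  Two distinct neighbours of \<open>v\<close> joined by a path off \<open>v\<close> would form a cycle with \<open>v\<close>. Its
  length is at least 3, so it is not one of the back-and-forth walks along a single edge.
\<close>

lemma nbrs_eq_if_joined_avoiding:
  assumes "u \<in> nbrs G v" "w \<in> nbrs G v"
    and "(u, w) \<in> {(a, b) \<in> parcs G. a \<noteq> v \<and> b \<noteq> v}\<^sup>*"
  shows "u = w"
proof (rule ccontr)
  assume "u \<noteq> w"
  have arcs: "(v, u) \<in> parcs G" "(w, v) \<in> parcs G"
    using assms(1,2) arc_swap by (auto simp: nbrs_def)
  then have "u \<noteq> v" "u \<in> pverts G" "v \<in> pverts G"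
    using no_loops'[of v u] in_arcsD1[of v u] in_arcsD2[of v u] by auto
  then obtain p where p: "apath u p w" "v \<notin> set (pawalk_verts u p)"
    using avoiding_walk_imp_apath[OF assms(3)] by blast
  have wp: "awalk u p w" using p(1) by (rule awalkI_apath)
  have "p \<noteq> []" using p(1) \<open>u \<noteq> w\<close> by (auto simp: apath_Nil_iff)
  let ?c = "(v, u) # p @ [(w, v)]"
  have wc: "awalk u (p @ [(w, v)]) v"
    using wp arcs \<open>v \<in> pverts G\<close> by (intro awalk_appendI) (auto simp: awalk_simps)
  have "pawalk_verts u (p @ [(w, v)]) = pawalk_verts u p @ [v]"
    using awalk_verts_append[OF wc] by auto
  then have "cycle ?c"
    using p wc arcs unfolding cycle_def apath_def
    by (intro exI[of _ v]) (auto simp: awalk_Cons_iff)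
  then have "length ?c < 3" by (rule no_cycle)
  then show False using \<open>p \<noteq> []\<close> by (cases p) auto
qed

definition depth :: "'a \<Rightarrow> nat" where
  "depth v = (LEAST n. (v, r) \<in> parcs G ^^ n)"

lemma walk_to_root:
  assumes "v \<in> pverts G"
  shows "(v, r) \<in> parcs G ^^ depth v"
proof -
  have "strongly_connected (with_proj G)"
    using pair_sym_arcs connected_tree by (rule symmetric_connected_imp_strongly_connected)
  then have "reachable (with_proj G) v r"
    using assms root_vert by (auto simp: strongly_connected_def)
  then have "(v, r) \<in> (parcs G)\<^sup>*" by (simp add: reachable_conv)
  then obtain n where "(v, r) \<in> parcs G ^^ n" using rtrancl_imp_relpow by blast
  then show ?thesis unfolding depth_def by (rule LeastI)
qed

lemma depth_root [simp]: "depth r = 0"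
  unfolding depth_def by (rule Least_eq_0) simp

lemma depth_eq_0: "v \<in> pverts G \<Longrightarrow> depth v = 0 \<Longrightarrow> v = r"
  using walk_to_root[of v] by simp

lemma exists_shallower_nbr:
  assumes "v \<in> pverts G" "v \<noteq> r"
  obtains u where "u \<in> nbrs G v" "depth v = Suc (depth u)"
proof -
  obtain n where n: "depth v = Suc n"
    using assms depth_eq_0 by (cases "depth v") auto
  then obtain u where u: "(v, u) \<in> parcs G" "(u, r) \<in> parcs G ^^ n"
    using walk_to_root[OF assms(1)] relpow_Suc_D2 by metis
  then have "depth u \<le> n" unfolding depth_def by (intro Least_le)
  moreover have "depth v \<le> Suc (depth u)"
    using relpow_Suc_I2[OF u(1) walk_to_root] u(1) in_arcsD2
    unfolding depth_def[of v] by (intro Least_le) auto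
  ultimately show thesis using that[of u] u(1) n by (auto simp: nbrs_def)
qed

text \<open>
  Along a shortest walk to the root the depth strictly decreases, so a walk that starts at a vertex
  other than \<open>v\<close> and no deeper than \<open>v\<close> never meets \<open>v\<close>.
\<close>

lemma walk_to_root_avoiding:
  assumes "u \<in> pverts G" "u \<noteq> v" "depth u \<le> depth v"
  shows "(u, r) \<in> {(a, b) \<in> parcs G. a \<noteq> v \<and> b \<noteq> v}\<^sup>*"
  using assms
proof (induction "depth u" arbitrary: u rule: less_induct)
  case less
  show ?case
  proof (cases "u = r")
    case False
    then obtain y where y: "y \<in> nbrs G u" "depth u = Suc (depth y)"
      using less.prems exists_shallower_nbr by blast
    then have "y \<noteq> v" "y \<in> pverts G" using less.prems nbrs_subset by auto
    then have "(y, r) \<in> {(a, b) \<in> parcs G. a \<noteq> v \<and> b \<noteq> v}\<^sup>*"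
      using y less by simp
    then show ?thesis
      using y less.prems \<open>y \<noteq> v\<close>
      by (intro converse_rtrancl_into_rtrancl[of u y]) (auto simp: nbrs_def)
  qed simp
qed

text \<open>
  Two such neighbours are joined off \<open>v\<close> through the root, which acyclicity forbids. Comparing with
  \<open>depth u \<le> depth v\<close> instead of \<open>depth u < depth v\<close> also excludes edges between vertices of equal
  depth, so that every neighbour of \<open>v\<close> is either its parent or one of its children.
\<close>

lemma nbr_not_deeper_unique:
  assumes "u \<in> nbrs G v" "depth u \<le> depth v"
    and "w \<in> nbrs G v" "depth w \<le> depth v"
  shows "u = w"
proof -
  let ?R = "{(a, b) \<in> parcs G. a \<noteq> v \<and> b \<noteq> v}"
  have "u \<noteq> v" "w \<noteq> v" using assms no_loops' by (auto simp: nbrs_def)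
  then have "(u, r) \<in> ?R\<^sup>*" "(w, r) \<in> ?R\<^sup>*"
    using assms nbrs_subset by (auto intro: walk_to_root_avoiding)
  moreover have "sym ?R" by (auto intro: symI arc_swap)
  ultimately have "(u, w) \<in> ?R\<^sup>*"
    by (meson rtrancl_trans sym_rtrancl symD)
  with assms show ?thesis by (intro nbrs_eq_if_joined_avoiding)
qed

text \<open>
  The root is its own parent, so that a chain of ancestors that reaches the root stays there.
\<close>

definition parent :: "'a \<Rightarrow> 'a" where
  "parent v = (if v = r then r else SOME u. u \<in> nbrs G v \<and> depth v = Suc (depth u))"

definition children :: "'a \<Rightarrow> 'a set" where
  "children v = {c \<in> pverts G. c \<noteq> r \<and> parent c = v}"

lemma parent_root [simp]: "parent r = r"
  by (simp add: parent_def)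

lemma
  assumes "v \<in> pverts G" "v \<noteq> r"
  shows parent_in_nbrs: "parent v \<in> nbrs G v"
    and depth_parent: "depth v = Suc (depth (parent v))"
proof -
  have "\<exists>u. u \<in> nbrs G v \<and> depth v = Suc (depth u)"
    using exists_shallower_nbr[OF assms] by metis
  from someI_ex[OF this] assms(2)
  show "parent v \<in> nbrs G v" "depth v = Suc (depth (parent v))"
    by (simp_all add: parent_def)
qed

lemma parent_eqI:
  assumes "u \<in> nbrs G v" "depth u \<le> depth v" "v \<noteq> r"
  shows "parent v = u"
  using assms nbrs_vertD[OF assms(1)] parent_in_nbrs depth_parent
  by (intro nbr_not_deeper_unique[of _ v]) auto

lemma parent_closed: "v \<in> pverts G \<Longrightarrow> parent v \<in> pverts G"
  using parent_in_nbrs nbrs_subset by (cases "v = r") auto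

lemma ancestor_closed: "v \<in> pverts G \<Longrightarrow> (parent ^^ n) v \<in> pverts G"
  by (induction n) (auto intro: parent_closed)

lemma child_in_nbrs: "c \<in> children v \<Longrightarrow> c \<in> nbrs G v"
  using parent_in_nbrs nbrs_sym by (auto simp: children_def)

lemma depth_child: "c \<in> children v \<Longrightarrow> depth c = Suc (depth v)"
  using depth_parent by (auto simp: children_def)

lemma nbrs_eq_parent_children:
  assumes "v \<in> pverts G" "v \<noteq> r"
  shows "nbrs G v = insert (parent v) (children v)"
proof (intro equalityI subsetI)
  fix u assume u: "u \<in> nbrs G v"
  show "u \<in> insert (parent v) (children v)"
  proof (cases "depth u \<le> depth v")
    case True
    then show ?thesis using parent_eqI u assms by blast
  next
    case False
    then have "u \<noteq> r" by auto
    moreover have "parent u = v"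
      using False u \<open>u \<noteq> r\<close> nbrs_sym by (intro parent_eqI) auto
    ultimately show ?thesis using u nbrs_subset by (auto simp: children_def)
  qed
next
  fix u assume "u \<in> insert (parent v) (children v)"
  then show "u \<in> nbrs G v" using parent_in_nbrs[OF assms] child_in_nbrs by auto
qed

end

section \<open>Distance to the nearest leaf below\<close>

locale root_reward_game = rooted_undirected_tree G r for G :: "'a pair_pre_digraph" and r +
  assumes root_leaf: "r \<in> leaves G"
begin

lemma inner_vertD:
  assumes "v \<in> Defs.inner_verts G"
  shows "v \<in> pverts G" "v \<noteq> r" "v \<notin> leaves G"
  using assms root_leaf by (auto simp: Defs.inner_verts_def)

lemma inner_has_child:
  assumes "v \<in> Defs.inner_verts G"
  shows "children v \<noteq> {}"
proof
  assume "children v = {}"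
  then have "nbrs G v = {parent v}"
    using nbrs_eq_parent_children inner_vertD[OF assms] by simp
  then show False using inner_vertD[OF assms] by (simp add: leaves_def)
qed

text \<open>
  The root is excluded because, unlike the leaves below \<open>v\<close>, it carries the reward.
\<close>

definition leaf_dist :: "'a \<Rightarrow> nat" where
  "leaf_dist v = (LEAST n. \<exists>b \<in> leaves G - {r}. (parent ^^ n) b = v)"

text \<open>
  A descent from child to child increases the depth, which is bounded in a finite graph, so it ends
  in a leaf.
\<close>

lemma exists_leaf_below:
  assumes "v \<in> pverts G" "v \<noteq> r"
  shows "\<exists>n. \<exists>b \<in> leaves G - {r}. (parent ^^ n) b = v"
  using assms
proof (induction "Max (depth ` pverts G) - depth v" arbitrary: v rule: less_induct)
  case less
  show ?case
  proof (cases "v \<in> leaves G")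
    case True
    then show ?thesis using less.prems by (intro exI[of _ 0]) auto
  next
    case False
    then obtain c where c: "c \<in> children v"
      using less.prems inner_has_child by (auto simp: Defs.inner_verts_def)
    then have cv: "c \<in> pverts G" "c \<noteq> r" "parent c = v" by (auto simp: children_def)
    then have "depth c \<le> Max (depth ` pverts G)" using pair_finite_verts by auto
    then have "Max (depth ` pverts G) - depth c < Max (depth ` pverts G) - depth v"
      using depth_child[OF c] by simp
    then obtain n b where "b \<in> leaves G - {r}" "(parent ^^ n) b = c"
      using less.hyps cv by blast
    then show ?thesis using cv by (intro exI[of _ "Suc n"] bexI[of _ b]) auto
  qed
qed

lemma leaf_dist_attained:
  assumes "v \<in> pverts G" "v \<noteq> r"
  obtains b where "b \<in> leaves G" "b \<noteq> r" "(parent ^^ leaf_dist v) b = v"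
  using LeastI_ex[OF exists_leaf_below[OF assms]] unfolding leaf_dist_def by auto

lemma leaf_dist_le: "b \<in> leaves G \<Longrightarrow> b \<noteq> r \<Longrightarrow> (parent ^^ n) b = v \<Longrightarrow> leaf_dist v \<le> n"
  unfolding leaf_dist_def by (intro Least_le) auto

lemma leaf_dist_leaf: "b \<in> leaves G \<Longrightarrow> b \<noteq> r \<Longrightarrow> leaf_dist b = 0"
  using leaf_dist_le[of b 0] by simp

lemma leaf_dist_le_Suc_child:
  assumes "c \<in> children v"
  shows "leaf_dist v \<le> Suc (leaf_dist c)"
proof -
  have c: "c \<in> pverts G" "c \<noteq> r" "parent c = v" using assms by (auto simp: children_def)
  then obtain b where "b \<in> leaves G" "b \<noteq> r" "(parent ^^ leaf_dist c) b = c"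
    by (metis leaf_dist_attained)
  then show ?thesis using c by (intro leaf_dist_le[of b]) auto
qed

text \<open>
  With \<open>leaf_dist_le_Suc_child\<close> this says that \<open>leaf_dist v\<close> is one more than the minimum of
  \<open>leaf_dist\<close> over the children. The child found here has the smallest value for every \<open>\<lambda> > 0\<close>.
\<close>

lemma leaf_dist_via_child:
  assumes "v \<in> Defs.inner_verts G"
  obtains c where "c \<in> children v" "leaf_dist v = Suc (leaf_dist c)"
proof -
  note v = inner_vertD[OF assms]
  obtain b where b: "b \<in> leaves G" "b \<noteq> r" "(parent ^^ leaf_dist v) b = v"
    using v leaf_dist_attained by metis
  obtain n where n: "leaf_dist v = Suc n"
    using b v by (cases "leaf_dist v") auto
  \<comment> \<open>the last vertex before \<open>v\<close> on the way up from a nearest leaf\<close>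
  define c where "c = (parent ^^ n) b"
  have pc: "parent c = v" using b(3) n by (simp add: c_def)
  moreover have "c \<in> pverts G"
    using b(1) unfolding c_def by (intro ancestor_closed) (simp add: leaves_def)
  moreover have "c \<noteq> r" using pc v by auto
  ultimately have c: "c \<in> children v" by (simp add: children_def)
  have "leaf_dist c \<le> n" using b c_def by (intro leaf_dist_le) auto
  then show thesis using that[OF c] leaf_dist_le_Suc_child[OF c] n by simp
qed

end

section \<open>The ratio of the values at a vertex and at its parent\<close>

text \<open>
  If the smallest value among the children is \<open>ratio k x\<close> times the value \<open>h\<close> at a vertex, and \<open>a\<close>
  is the value at its parent, then \<open>h = x / (x + 1) * a + 1 / (x + 1) * ratio k x * h\<close>. Solving for
  \<open>h\<close> gives \<open>h = ratio (Suc k) x * a\<close>.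
\<close>

primrec ratio :: "nat \<Rightarrow> real \<Rightarrow> real" where
  "ratio 0 x = 0"
| "ratio (Suc k) x = x / (x + 1 - ratio k x)"

lemma ratio_bounds: "x > 0 \<Longrightarrow> 0 \<le> ratio k x \<and> ratio k x < 1"
  by (induction k) auto

lemma ratio_nonneg: "x > 0 \<Longrightarrow> 0 \<le> ratio k x"
  and ratio_less_1: "x > 0 \<Longrightarrow> ratio k x < 1"
  using ratio_bounds by auto

lemma ratio_mono:
  assumes "x > 0" "j \<le> k"
  shows "ratio j x \<le> ratio k x"
proof -
  have "ratio n x \<le> ratio (Suc n) x" for n
  proof (induction n)
    case 0
    show ?case using assms(1) by simp
  next
    case (Suc n)
    \<comment> \<open>the map \<open>t \<mapsto> x / (x + 1 - t)\<close> is increasing below 1, and both arguments lie there\<close>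
    have "x / (x + 1 - ratio n x) \<le> x / (x + 1 - ratio (Suc n) x)"
      using Suc assms(1) ratio_less_1[OF assms(1), of "Suc n"]
      by (intro frac_le; linarith)
    then show ?case by (simp only: ratio.simps)
  qed
  then show ?thesis using assms(2) by (rule lift_Suc_mono_le)
qed

lemma ratio_differentiable:
  assumes "x > 0"
  shows "ratio k differentiable (at x)"
proof (induction k)
  case 0
  have "ratio 0 = (\<lambda>x. 0)" by auto
  then show ?case by simp
next
  case (Suc k)
  have "ratio (Suc k) = (\<lambda>x. x / (x + 1 - ratio k x))" by auto
  then show ?case using Suc ratio_less_1[OF assms, of k] assms
    by (auto intro!: differentiable_divide differentiable_diff differentiable_add)
qed

section \<open>The value as a product along the path to the root\<close>

context root_reward_game
begin

definition path_value :: "real \<Rightarrow> 'a \<Rightarrow> real" where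
  "path_value x v = (\<Prod>i<depth v. ratio (leaf_dist ((parent ^^ i) v)) x)"

lemma path_value_root [simp]: "path_value x r = 1"
  by (simp add: path_value_def)

lemma path_value_parent:
  assumes "v \<in> pverts G" "v \<noteq> r"
  shows "path_value x v = ratio (leaf_dist v) x * path_value x (parent v)"
  unfolding path_value_def depth_parent[OF assms]
  by (simp add: prod.lessThan_Suc_shift funpow_swap1 del: prod.lessThan_Suc)

lemma path_value_nonneg: "x > 0 \<Longrightarrow> path_value x v \<ge> 0"
  unfolding path_value_def by (intro prod_nonneg) (auto simp: ratio_nonneg)

lemma path_value_le_parent:
  assumes "x > 0" "v \<in> pverts G" "v \<noteq> r"
  shows "path_value x v \<le> path_value x (parent v)"
  using path_value_parent[OF assms(2,3)] path_value_nonneg[OF assms(1), of "parent v"]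
    ratio_less_1[OF assms(1), of "leaf_dist v"]
  by (simp add: mult_left_le_one_le ratio_nonneg assms(1))

lemma path_value_differentiable:
  assumes "x > 0"
  shows "(\<lambda>x. path_value x v) differentiable (at x)"
proof -
  have "\<exists>D. (ratio k has_derivative D) (at x)" for k
    using ratio_differentiable[OF assms] by (simp add: differentiable_def)
  then obtain D where D: "\<And>k. (ratio k has_derivative D k) (at x)" by metis
  show ?thesis
    unfolding path_value_def differentiable_def
    using has_derivative_prod[where I = "{..<depth v}"
        and f = "\<lambda>i. ratio (leaf_dist ((parent ^^ i) v))", OF D] by blast
qed

text \<open>
  All ratios are below 1, so values do not decrease on the way to the root.
\<close>

lemma Max_path_value_nbrs:
  assumes "x > 0" "v \<in> Defs.inner_verts G"
  shows "Max (path_value x ` nbrs G v) = path_value x (parent v)"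
proof (rule Max_eqI)
  note v = inner_vertD[OF assms(2)]
  show "finite (path_value x ` nbrs G v)" using finite_nbrs by simp
  show "path_value x (parent v) \<in> path_value x ` nbrs G v"
    using parent_in_nbrs v by blast
  fix y assume "y \<in> path_value x ` nbrs G v"
  then consider "y = path_value x (parent v)" | c where "c \<in> children v" "y = path_value x c"
    using nbrs_eq_parent_children v by auto
  then show "y \<le> path_value x (parent v)"
  proof cases
    case (2 c)
    then have "y \<le> path_value x v"
      using path_value_le_parent[OF assms(1), of c] by (auto simp: children_def)
    then show ?thesis using path_value_le_parent[OF assms(1)] v by force
  qed simp
qed

text \<open>
  The value at a child \<open>d\<close> is \<open>ratio (leaf_dist d) x\<close> times the value at \<open>v\<close>, and the ratio increases
  with the leaf distance, so a child closest to a leaf has the smallest value.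
\<close>

lemma Min_path_value_nbrs:
  assumes "x > 0" "v \<in> Defs.inner_verts G"
    and c: "c \<in> children v" "leaf_dist v = Suc (leaf_dist c)"
  shows "Min (path_value x ` nbrs G v) = ratio (leaf_dist c) x * path_value x v"
proof (rule Min_eqI)
  note v = inner_vertD[OF assms(2)]
  have child: "path_value x d = ratio (leaf_dist d) x * path_value x v" if "d \<in> children v" for d
    using that path_value_parent by (auto simp: children_def)
  show "finite (path_value x ` nbrs G v)" using finite_nbrs by simp
  show "ratio (leaf_dist c) x * path_value x v \<in> path_value x ` nbrs G v"
    using child[OF c(1)] child_in_nbrs[OF c(1)] by force
  fix y assume "y \<in> path_value x ` nbrs G v"
  then consider "y = path_value x (parent v)" | d where "d \<in> children v" "y = path_value x d"
    using nbrs_eq_parent_children v by auto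
  then show "ratio (leaf_dist c) x * path_value x v \<le> y"
  proof cases
    case 1
    have "ratio (leaf_dist c) x * path_value x v \<le> path_value x v"
      using path_value_nonneg ratio_nonneg ratio_less_1[of x "leaf_dist c"] assms(1)
      by (intro mult_left_le_one_le) auto
    then show ?thesis using 1 path_value_le_parent[OF assms(1)] v by force
  next
    case (2 d)
    have "leaf_dist c \<le> leaf_dist d" using leaf_dist_le_Suc_child[OF 2(1)] c(2) by simp
    then show ?thesis using 2 child[OF 2(1)] assms(1)
      by (auto intro: mult_right_mono ratio_mono path_value_nonneg)
  qed
qed

lemma path_value_is_value:
  assumes "x > 0"
  shows "is_value G (indicator {r}) x (restrict (path_value x) (pverts G))"
  unfolding is_value_def
proof (intro conjI ballI)
  show "restrict (path_value x) (pverts G) \<in> pverts G \<rightarrow>\<^sub>E {0..}"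
    using path_value_nonneg[OF assms] by auto
next
  fix b assume b: "b \<in> leaves G"
  then have "b \<in> pverts G" by (simp add: leaves_def)
  then show "restrict (path_value x) (pverts G) b = indicator {r} b"
    using path_value_parent[of b x] leaf_dist_leaf[OF b] by (cases "b = r") auto
next
  fix v assume v: "v \<in> Defs.inner_verts G"
  note vD = inner_vertD[OF v]
  obtain c where c: "c \<in> children v" "leaf_dist v = Suc (leaf_dist c)"
    using leaf_dist_via_child[OF v] by blast
  let ?q = "ratio (leaf_dist c) x"
  have image: "restrict (path_value x) (pverts G) ` nbrs G v = path_value x ` nbrs G v"
    using nbrs_subset by (intro image_cong) auto
  have pos: "x + 1 - ?q > 0" using ratio_less_1[OF assms, of "leaf_dist c"] assms by linarith
  have "path_value x v = x / (x + 1 - ?q) * path_value x (parent v)"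
    using path_value_parent[OF vD(1,2)] c(2) by simp
  then have "path_value x v * (x + 1 - ?q) = x * path_value x (parent v)"
    using pos by (simp add: field_simps)
  then have "path_value x v * (x + 1) = x * path_value x (parent v) + ?q * path_value x v"
    by (simp add: algebra_simps)
  then have "path_value x v =
      (x * path_value x (parent v) + ?q * path_value x v) / (x + 1)"
    using assms by (simp add: eq_divide_eq)
  then have "path_value x v =
      x / (x + 1) * path_value x (parent v) + 1 / (x + 1) * (?q * path_value x v)"
    by (simp add: add_divide_distrib)
  then show "restrict (path_value x) (pverts G) v =
      x / (x + 1) * Max (restrict (path_value x) (pverts G) ` nbrs G v) +
      1 / (x + 1) * Min (restrict (path_value x) (pverts G) ` nbrs G v)"
    using Max_path_value_nbrs[OF assms v] Min_path_value_nbrs[OF assms v c] vD(1) image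
    by simp
qed

section \<open>Uniqueness of the value\<close>

text \<open>
  Let \<open>M > 0\<close> be the maximum of \<open>f - g\<close>, and among the vertices where it is attained take one where
  \<open>f\<close> is largest. Both extrema in the equation have positive weight, so the maxima of \<open>f\<close> and \<open>g\<close>
  over the neighbours differ by exactly \<open>M\<close>; hence a neighbour maximizing \<open>f\<close> also attains \<open>M\<close>. By
  the choice of the vertex this neighbour has no larger \<open>f\<close>, which forces \<open>f\<close> to be constant on
  all neighbours. So the parent is again such a vertex. Climbing to the root, where \<open>f = g\<close>,
  gives a contradiction.

  Looking at \<open>f - g\<close> alone would not suffice: the vertices where the two equations attain their
  extrema may differ, and nothing would carry the maximum of \<open>f - g\<close> to a chosen neighbour.
\<close>

lemma value_le:
  assumes x: "x > 0" and f: "is_value G p x f" and g: "is_value G p x g"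
    and v: "v \<in> pverts G"
  shows "f v \<le> g v"
proof (rule ccontr)
  assume "\<not> f v \<le> g v"
  define M where "M = Max ((\<lambda>w. f w - g w) ` pverts G)"
  have M_ge: "f w - g w \<le> M" if "w \<in> pverts G" for w
    unfolding M_def using that pair_finite_verts by auto
  have "M > 0" using M_ge[OF v] \<open>\<not> f v \<le> g v\<close> by simp
  define A where "A = {w \<in> pverts G. f w - g w = M}"
  have "M \<in> (\<lambda>w. f w - g w) ` pverts G"
    unfolding M_def using v pair_finite_verts by (intro Max_in) auto
  then have "A \<noteq> {}" by (auto simp: A_def)
  have "finite A" using pair_finite_verts by (simp add: A_def)
  define F where "F = Max (f ` A)"
  have F_ge: "f w \<le> F" if "w \<in> A" for w
    unfolding F_def using that \<open>finite A\<close> by auto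
  have "F \<in> f ` A" unfolding F_def using \<open>finite A\<close> \<open>A \<noteq> {}\<close> by (intro Max_in) auto
  then obtain w0 where w0: "w0 \<in> A" "f w0 = F" by auto
  have parent_step: "parent w \<in> A \<and> f (parent w) = F"
    if w: "w \<in> A" "f w = F" "w \<noteq> r" for w
  proof -
    let ?N = "nbrs G w"
    have wV: "w \<in> pverts G" and wM: "f w - g w = M" using w by (auto simp: A_def)
    have "w \<notin> leaves G" using f g wM \<open>M > 0\<close> by (auto simp: is_value_def)
    then have wi: "w \<in> Defs.inner_verts G" using wV by (simp add: Defs.inner_verts_def)
    have pN: "parent w \<in> ?N" using parent_in_nbrs wV w(3) by simp
    then have ne: "?N \<noteq> {}" by auto
    have fin: "finite (f ` ?N)" "finite (g ` ?N)" using finite_nbrs by auto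
    define a b where "a = x / (x + 1)" and "b = 1 / (x + 1)"
    have ab: "a > 0" "b > 0" "a + b = 1" using x by (auto simp: a_def b_def field_simps)
    have fw: "f w = a * Max (f ` ?N) + b * Min (f ` ?N)"
      and gw: "g w = a * Max (g ` ?N) + b * Min (g ` ?N)"
      using f g wi by (auto simp: is_value_def a_def b_def)
    have "Max (f ` ?N) \<in> f ` ?N" using fin ne by (intro Max_in) auto
    then obtain u where u: "u \<in> ?N" "f u = Max (f ` ?N)" by auto
    have "Min (g ` ?N) \<in> g ` ?N" using fin ne by (intro Min_in) auto
    then obtain t where t: "t \<in> ?N" "g t = Min (g ` ?N)" by auto
    have uV: "u \<in> pverts G" "t \<in> pverts G" using u t nbrs_subset by auto
    have gu: "g u \<le> Max (g ` ?N)" using u fin by auto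
    have ft: "Min (f ` ?N) \<le> f t" using t fin by auto
    have dmax: "Max (f ` ?N) - Max (g ` ?N) \<le> M" using gu u M_ge[OF uV(1)] by linarith
    have dmin: "Min (f ` ?N) - Min (g ` ?N) \<le> M" using ft t M_ge[OF uV(2)] by linarith
    \<comment> \<open>\<open>M\<close> is a weighted mean of two numbers that do not exceed \<open>M\<close>, so both equal \<open>M\<close>\<close>
    have "a * (M - (Max (f ` ?N) - Max (g ` ?N))) + b * (M - (Min (f ` ?N) - Min (g ` ?N)))
        = (a + b) * M - (f w - g w)"
      unfolding fw gw by (simp add: algebra_simps)
    also have "\<dots> = 0" using ab wM by simp
    finally have sum0: "a * (M - (Max (f ` ?N) - Max (g ` ?N)))
        + b * (M - (Min (f ` ?N) - Min (g ` ?N))) = 0" .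
    have "a * (M - (Max (f ` ?N) - Max (g ` ?N))) \<ge> 0"
      "b * (M - (Min (f ` ?N) - Min (g ` ?N))) \<ge> 0" using dmax dmin ab by simp_all
    with sum0 have "a * (M - (Max (f ` ?N) - Max (g ` ?N))) = 0" by linarith
    then have Meq: "Max (f ` ?N) - Max (g ` ?N) = M" using ab by simp
    have "u \<in> A" using M_ge[OF uV(1)] Meq gu u uV by (auto simp: A_def)
    then have maxF: "Max (f ` ?N) \<le> F" using F_ge u by fastforce
    \<comment> \<open>likewise \<open>F\<close> is a weighted mean of two numbers that do not exceed \<open>F\<close>\<close>
    have "a * (F - Max (f ` ?N)) + b * (F - Min (f ` ?N)) = (a + b) * F - f w"
      unfolding fw by (simp add: algebra_simps)
    also have "\<dots> = 0" using ab w by simp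
    finally have sumF: "a * (F - Max (f ` ?N)) + b * (F - Min (f ` ?N)) = 0" .
    have "Min (f ` ?N) \<le> f (parent w)" "f (parent w) \<le> Max (f ` ?N)" using fin pN by auto
    moreover from this have "a * (F - Max (f ` ?N)) \<ge> 0" "b * (F - Min (f ` ?N)) \<ge> 0"
      using maxF ab by simp_all
    with sumF have "b * (F - Min (f ` ?N)) = 0" by linarith
    then have "Min (f ` ?N) = F" using ab by simp
    ultimately have fp: "f (parent w) = F" and "Max (f ` ?N) = F" using maxF by linarith+
    have "g (parent w) \<le> Max (g ` ?N)" using fin pN by auto
    then have "f (parent w) - g (parent w) \<ge> M" using fp Meq \<open>Max (f ` ?N) = F\<close> by linarith
    then have "parent w \<in> A" using M_ge parent_closed[OF wV] by (fastforce simp: A_def)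
    with fp show ?thesis by simp
  qed
  have "r \<in> A" if "w \<in> A" "f w = F" for w
    using that
  proof (induction "depth w" arbitrary: w)
    case 0
    then show ?case using depth_eq_0 by (auto simp: A_def)
  next
    case (Suc n)
    then have "w \<noteq> r" "w \<in> pverts G" by (auto simp: A_def)
    then show ?case using Suc parent_step depth_parent[of w] by simp
  qed
  then have "r \<in> A" using w0 by blast
  then show False using f g root_leaf \<open>M > 0\<close> by (auto simp: A_def is_value_def)
qed

lemma value_unique:
  assumes "x > 0" "is_value G p x f" "is_value G p x g"
  shows "f = g"
proof (rule PiE_ext)
  show "f \<in> pverts G \<rightarrow>\<^sub>E {0..}" "g \<in> pverts G \<rightarrow>\<^sub>E {0..}"
    using assms by (auto simp: is_value_def)
  show "f w = g w" if "w \<in> pverts G" for w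
    using that value_le assms by (metis order_antisym)
qed

lemma value_fun_eq_path_value:
  assumes "x > 0" "v \<in> pverts G"
  shows "value_fun G r x v = path_value x v"
proof -
  have "value_fun G r x = restrict (path_value x) (pverts G)"
    unfolding value_fun_def
    using path_value_is_value[OF assms(1)] value_unique[OF assms(1)] by (intro the_equality) auto
  then show ?thesis using assms(2) by simp
qed

end

section \<open>Differentiability\<close>

lemma root_reward_game_if_root_reward_tree:
  assumes "root_reward_tree G r"
  shows "root_reward_game G r"
proof -
  have tree: "undirected_tree G" and leaf: "r \<in> leaves G"
    using assms by (auto simp: root_reward_tree_def)
  interpret pair_graph G using tree by (simp add: undirected_tree_def)
  show ?thesis
    using tree leaf by unfold_locales (auto simp: undirected_tree_def leaves_def not_le[symmetric])
qed

theorem proposition1p9: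
  fixes G :: "'a pair_pre_digraph" and r v :: 'a
  assumes "root_reward_tree G r"
    and "v \<in> inner_verts G"
  shows "\<forall>l>0. (\<lambda>x. value_fun G r x v) differentiable (at l)"
proof (intro allI impI)
  fix l :: real assume l: "l > 0"
  interpret root_reward_game G r
    using assms(1) by (rule root_reward_game_if_root_reward_tree)
  have v: "v \<in> pverts G" using assms(2) by (rule inner_vertD)
  obtain D where D: "((\<lambda>x. path_value x v) has_derivative D) (at l)"
    using path_value_differentiable[OF l] by (auto simp: differentiable_def)
  \<comment> \<open>the two functions agree on the whole positive half-line, a neighbourhood of \<open>l\<close>\<close>
  have "((\<lambda>x. value_fun G r x v) has_derivative D) (at l)"
    using D
  proof (rule has_derivative_transform_within_open[where s = "{0<..}"])
    show "path_value x v = value_fun G r x v" if "x \<in> {0<..}" for x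
      using that value_fun_eq_path_value[OF _ v] by simp
  qed (use l in auto)
  then show "(\<lambda>x. value_fun G r x v) differentiable (at l)"
    by (auto simp: differentiable_def)
qed

end
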